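(* Let $\tau\in\mathbb{C}$ with $\operatorname{Im}\tau>0$, $q=e^{2\pi i\tau}$, $\Gamma=\mathbb{Z}\tau+\mathbb{Z}$. Let $A$ and $A'$ be $r$-dimensional $\mathbb{C}^*$-factors of automorphy depending only on the $\tau$-direction, with $A(m,u):=A(m\tau,u)$, $A(u):=A(1,u)$, and likewise for $A'$. Then $A(m,u)$ is uniquely determined by $A(u)$, namely for all $u\in\mathbb{C}^*$ $$A(m,u)=A(q^{m-1}u)\cdots A(qu)A(u),\qquad m>0,$$ $$A(-m,u)=A(q^{-m}u)^{-1}\cdots A(q^{-1}u)^{-1},\qquad m>0.$$ Moreover, $A(m,u)$ is equivalent to $A'(m,u)$ if and only if $$A(u)B(u)=B(qu)A'(u)\quad\text{for all }u\in\mathbb{C}^*$$ for some holomorphic function $B:\mathbb{C}^*\to\mathrm{GL}_r(\mathbb{C})$. In particular, $A(m,u)$ is trivial if and only if $A(u)=B(qu)B(u)^{-1}$ for some holomorphic $B:\mathbb{C}^*\to\mathrm{GL}_r(\mathbb{C})$.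
   Context: $\Gamma$ acts on $\mathbb{C}^*$ by $\lambda u:=e^{2\pi i\lambda}u$. An $r$-dimensional $\mathbb{C}^*$-factor of automorphy is a holomorphic function $A:\Gamma\times\mathbb{C}^*\to\mathrm{GL}_r(\mathbb{C})$ (holomorphic in the second variable) satisfying $A(\lambda+\lambda',u)=A(\lambda,\lambda'u)A(\lambda',u)$ for all $\lambda,\lambda'\in\Gamma$, $u\in\mathbb{C}^*$. It depends only on the $\tau$-direction if $A(m\tau+n,u)=A(m\tau,u)$ for all $m,n\in\mathbb{Z}$. Two such factors $A,A'$ are equivalent if there is a holomorphic $B:\mathbb{C}^*\to\mathrm{GL}_r(\mathbb{C})$ with $A(m,u)B(u)=B(q^mu)A'(m,u)$ for all $m\in\mathbb{Z}$, $u\in\mathbb{C}^*$. $A$ is trivial if it is equivalent to the factor that is constantly the identity matrix. *)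

theory Defs
  imports "HOL-Analysis.Analysis"
begin

definition nome :: "complex \<Rightarrow> complex" where
  "nome \<tau> = exp (2 * of_real pi * \<i> * \<tau>)"

definition lattice :: "complex \<Rightarrow> complex set" where
  "lattice \<tau> = {of_int m * \<tau> + of_int n | m n :: int. True}"

definition lattice_act :: "complex \<Rightarrow> complex \<Rightarrow> complex" where
  "lattice_act l u = exp (2 * of_real pi * \<i> * l) * u"

definition holomorphic_GL_on :: "(complex \<Rightarrow> complex^'n^'n) \<Rightarrow> complex set \<Rightarrow> bool" where
  "holomorphic_GL_on B S \<longleftrightarrow>
     (\<forall>i j. (\<lambda>u. B u $ i $ j) holomorphic_on S) \<and> (\<forall>u\<in>S. invertible (B u))"

text \<open>
  \<open>\<complex>\<^sup>*\<close> is the set \<open>-{0}\<close>, and the rank \<open>r\<close> is \<open>CARD('n)\<close>. Factors are total functions whose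
  values outside \<open>\<Gamma> \<times> \<complex>\<^sup>*\<close> are unconstrained and irrelevant.
\<close>

definition factor_of_automorphy ::
    "complex \<Rightarrow> (complex \<Rightarrow> complex \<Rightarrow> complex^'n^'n) \<Rightarrow> bool" where
  "factor_of_automorphy \<tau> A \<longleftrightarrow>
     (\<forall>l\<in>lattice \<tau>. holomorphic_GL_on (A l) (-{0})) \<and>
     (\<forall>l\<in>lattice \<tau>. \<forall>l'\<in>lattice \<tau>. \<forall>u\<in>-{0}.
        A (l + l') u = A l (lattice_act l' u) ** A l' u)"

definition depends_only_on_tau ::
    "complex \<Rightarrow> (complex \<Rightarrow> complex \<Rightarrow> complex^'n^'n) \<Rightarrow> bool" where
  "depends_only_on_tau \<tau> A \<longleftrightarrow>
     (\<forall>(m::int) (n::int). \<forall>u\<in>-{0}. A (of_int m * \<tau> + of_int n) u = A (of_int m * \<tau>) u)"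

definition tau_part ::
    "complex \<Rightarrow> (complex \<Rightarrow> complex \<Rightarrow> complex^'n^'n) \<Rightarrow> int \<Rightarrow> complex \<Rightarrow> complex^'n^'n" where
  "tau_part \<tau> A m u = A (of_int m * \<tau>) u"

text \<open>Equivalence and triviality are meant for factors depending only on the \<open>\<tau>\<close>-direction.\<close>

definition equivalent_factors ::
    "complex \<Rightarrow> (complex \<Rightarrow> complex \<Rightarrow> complex^'n^'n) \<Rightarrow>
       (complex \<Rightarrow> complex \<Rightarrow> complex^'n^'n) \<Rightarrow> bool" where
  "equivalent_factors \<tau> A A' \<longleftrightarrow>
     (\<exists>B. holomorphic_GL_on B (-{0}) \<and>
        (\<forall>(m::int). \<forall>u\<in>-{0}.
           tau_part \<tau> A m u ** B u = B (nome \<tau> powi m * u) ** tau_part \<tau> A' m u))"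

definition trivial_factor ::
    "complex \<Rightarrow> (complex \<Rightarrow> complex \<Rightarrow> complex^'n^'n) \<Rightarrow> bool" where
  "trivial_factor \<tau> A \<longleftrightarrow> equivalent_factors \<tau> A (\<lambda>l u. mat 1)"

text \<open>
  The product of a list of matrices in the order of the list. It cannot be \<open>prod_list\<close>, because
  \<open>*\<close> on \<open>complex^'n^'n\<close> is componentwise.
\<close>

definition matrix_prod_list :: "(complex^'n^'n) list \<Rightarrow> complex^'n^'n" where
  "matrix_prod_list Ms = foldr (**) Ms (mat 1)"

end

theory Submission
  imports Defs
begin

text \<open>
  Since \<open>A(0,u) = 1\<close> and \<open>A(m+1,u) = A(1,q\<^sup>mu) A(m,u)\<close>, with \<open>A(1,q\<^sup>mu)\<close> invertible, the
  cocycle is generated by \<open>A(1,u)\<close> in both directions of \<open>\<int>\<close>. An intertwiner \<open>B\<close> at \<open>m = 1\<close>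
  therefore propagates to all \<open>m\<close>; uniqueness is the special case \<open>B = 1\<close>, and triviality the
  case where the second cocycle is \<open>1\<close>.
\<close>

lemma matrix_inv_right_inverse:
  fixes M :: "'a::semiring_1^'n^'n"
  assumes "invertible M"
  shows "M ** matrix_inv M = mat 1" "matrix_inv M ** M = mat 1"
  using someI_ex[OF assms[unfolded invertible_def]] by (auto simp: matrix_inv_def)

lemma invertible_mult_left_cancel:
  fixes M :: "'a::semiring_1^'n^'n" and X Y :: "'a^'k^'n"
  assumes "invertible M" "M ** X = M ** Y"
  shows "X = Y"
  using assms by (metis invertible_def matrix_mul_assoc matrix_mul_lid)

lemma invertible_mult_right_iff:
  fixes M X Y :: "'a::semiring_1^'n^'n"
  assumes "invertible M"
  shows "X ** M = Y \<longleftrightarrow> X = Y ** matrix_inv M"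
  using matrix_inv_right_inverse[OF assms] by (metis matrix_mul_assoc matrix_mul_rid)

lemma matrix_prod_list_simps [simp]:
  "matrix_prod_list [] = mat 1"
  "matrix_prod_list (M # Ms) = M ** matrix_prod_list Ms"
  by (simp_all add: matrix_prod_list_def)

text \<open>A 1-cocycle of \<int> acting on the punctured plane through powers of \<open>q\<close>,
  with values in GL_r. Holomorphy is left out because every identity below is pointwise in
  \<open>u\<close>.\<close>

locale q_cocycle =
  fixes q :: complex and C :: "int \<Rightarrow> complex \<Rightarrow> complex^'n^'n"
  assumes q_nonzero: "q \<noteq> 0"
    and invertible: "u \<noteq> 0 \<Longrightarrow> invertible (C m u)"
    and cocycle: "u \<noteq> 0 \<Longrightarrow> C (m + n) u = C m (q powi n * u) ** C n u"
begin

text \<open>The cocycle law at \<open>m = n = 0\<close> makes \<open>C 0 u\<close> idempotent, and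
  an invertible idempotent is the identity.\<close>

lemma zero: "u \<noteq> 0 \<Longrightarrow> C 0 u = mat 1"
  using cocycle[of u 0 0] invertible_mult_left_cancel[OF invertible, of u 0 "C 0 u" "mat 1"]
  by simp

lemma step: "u \<noteq> 0 \<Longrightarrow> C (m + 1) u = C 1 (q powi m * u) ** C m u"
  using cocycle[of u 1 m] by (simp add: add.commute)

text \<open>Split \<open>0 = 1 + (- 1)\<close>: after the step by -1 the base point is
  \<open>u / q\<close>, which is why the inverse is taken there and not at \<open>u\<close>.\<close>

lemma minus_one:
  assumes "u \<noteq> 0"
  shows "C (- 1) u = matrix_inv (C 1 (q powi (- 1) * u))"
proof -
  let ?M = "C 1 (q powi (- 1) * u)"
  have inv: "invertible ?M"
    using assms q_nonzero by (intro invertible) simp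
  have "?M ** C (- 1) u = ?M ** matrix_inv ?M"
    using cocycle[OF assms, of 1 "- 1"] zero[OF assms] matrix_inv_right_inverse[OF inv] by simp
  then show ?thesis
    by (rule invertible_mult_left_cancel[OF inv])
qed

text \<open>Each \<open>step\<close> multiplies on the left by the value at the newest orbit point,
  so the list runs from the highest power of \<open>q\<close> down to \<open>q ^ 0\<close>.\<close>

lemma nonneg_eq_prod:
  assumes "u \<noteq> 0"
  shows "C (int m) u = matrix_prod_list (map (\<lambda>k. C 1 (q ^ k * u)) (rev [0..<m]))"
proof (induction m)
  case 0
  then show ?case using zero[OF assms] by simp
next
  case (Suc m)
  then show ?case using step[OF assms, of "int m"] by (simp add: add.commute)
qed

lemma nonpos_eq_prod:
  assumes "u \<noteq> 0"
  shows "C (- int m) u =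
    matrix_prod_list (map (\<lambda>k. matrix_inv (C 1 (q powi (- int k) * u))) (rev [1..<Suc m]))"
proof (induction m)
  case 0
  then show ?case using zero[OF assms] by simp
next
  case (Suc m)
  let ?v = "q powi (- int m) * u"
  have v: "?v \<noteq> 0"
    using assms q_nonzero by simp
  \<comment> \<open>Split \<open>- int (Suc m)\<close> as \<open>- 1 + (- int m)\<close>:
    \<open>minus_one\<close> based at \<open>?v\<close> supplies the new leftmost factor. As it
    looks one point further back, the indices run over 1..m and not 0..m-1.\<close>
  have "q powi (- 1) * ?v = q powi (- int (Suc m)) * u"
    using q_nonzero power_int_add[of q "- 1" "- int m"] by (simp flip: mult.assoc)
  then have "C (- 1) ?v = matrix_inv (C 1 (q powi (- int (Suc m)) * u))"
    using minus_one[OF v] by (simp only:)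
  moreover have "C (- int (Suc m)) u = C (- 1) ?v ** C (- int m) u"
    using cocycle[OF assms, of "- 1" "- int m"] by simp
  ultimately have "C (- int (Suc m)) u =
      matrix_inv (C 1 (q powi (- int (Suc m)) * u)) ** C (- int m) u"
    by (simp only:)
  then show ?case
    unfolding Suc.IH by (simp del: of_nat_Suc)
qed

end

lemma q_cocycle_intertwines:
  assumes "q_cocycle q C" "q_cocycle q C'"
    and gen: "\<And>u. u \<noteq> 0 \<Longrightarrow> C 1 u ** B u = B (q * u) ** C' 1 u"
    and u: "u \<noteq> 0"
  shows "C m u ** B u = B (q powi m * u) ** C' m u"
proof -
  interpret C: q_cocycle q C by fact
  interpret C': q_cocycle q C' by fact
  have nz: "q powi k * u \<noteq> 0" for k
    using u C.q_nonzero by simp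
  have shift: "q * (q powi k * u) = q powi (k + 1) * u" for k
    using C.q_nonzero by (simp add: power_int_add)
  \<comment> \<open>The generator relation at the k-th orbit point. The trailing \<open>X\<close>
    will be \<open>C' k u\<close> or \<open>C' (k - 1) u\<close>, so that the relation can be used
    inside a longer product.\<close>
  have gen_k: "C 1 (q powi k * u) ** B (q powi k * u) ** X =
      B (q powi (k + 1) * u) ** C' 1 (q powi k * u) ** X" for k X
    using gen[OF nz, of k] by (simp add: shift)
  show ?thesis
  proof (induction m rule: int_induct[where k = 0])
    case base
    then show ?case using C.zero[OF u] C'.zero[OF u] by simp
  next
    case (step1 k)
    then show ?case
      using gen_k[of k "C' k u"] C.step[OF u, of k] C'.step[OF u, of k]
      by (metis matrix_mul_assoc)
  next
    case (step2 k)
    have k: "k - 1 + 1 = k" by simp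
    \<comment> \<open>Descent: by \<open>step\<close> and \<open>gen_k\<close>, the relation at
      \<open>k\<close> is the relation at \<open>k - 1\<close> multiplied on the left by
      \<open>C 1 (q powi (k - 1) * u)\<close>, which is invertible and cancels.\<close>
    have "C 1 (q powi (k - 1) * u) ** (C (k - 1) u ** B u) =
        C 1 (q powi (k - 1) * u) ** (B (q powi (k - 1) * u) ** C' (k - 1) u)"
      using step2 gen_k[of "k - 1" "C' (k - 1) u"] C.step[OF u, of "k - 1"]
        C'.step[OF u, of "k - 1"]
      unfolding k by (metis matrix_mul_assoc)
    then show ?case
      by (rule invertible_mult_left_cancel[OF C.invertible[OF nz]])
  qed
qed

lemma lattice_act_of_int: "lattice_act (of_int n * \<tau>) u = nome \<tau> powi n * u"
  by (simp add: lattice_act_def nome_def exp_power_int mult_ac)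

lemma of_int_mult_in_lattice: "of_int m * \<tau> \<in> lattice \<tau>"
  unfolding lattice_def by (force intro: exI[of _ 0])

text \<open>The multiples of \<open>\<tau>\<close> form a copy of \<int> inside the lattice, and
  \<open>n * \<tau>\<close> acts on \<open>u\<close> as multiplication by the n-th power of the
  nome.\<close>

lemma factor_of_automorphy_q_cocycle:
  assumes "factor_of_automorphy \<tau> A"
  shows "q_cocycle (nome \<tau>) (tau_part \<tau> A)"
proof
  show "nome \<tau> \<noteq> 0"
    by (simp add: nome_def)
next
  fix u :: complex and m :: int
  assume "u \<noteq> 0"
  then show "invertible (tau_part \<tau> A m u)"
    using assms of_int_mult_in_lattice
    by (auto simp: factor_of_automorphy_def holomorphic_GL_on_def tau_part_def)
next
  fix u :: complex and m n :: int
  assume "u \<noteq> 0"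
  then have "A (of_int m * \<tau> + of_int n * \<tau>) u =
      A (of_int m * \<tau>) (lattice_act (of_int n * \<tau>) u) ** A (of_int n * \<tau>) u"
    using assms of_int_mult_in_lattice by (auto simp: factor_of_automorphy_def)
  then show "tau_part \<tau> A (m + n) u =
      tau_part \<tau> A m (nome \<tau> powi n * u) ** tau_part \<tau> A n u"
    by (simp add: tau_part_def lattice_act_of_int distrib_right)
qed

lemma equivalent_factors_iff_generator:
  assumes "q_cocycle (nome \<tau>) (tau_part \<tau> A)" "q_cocycle (nome \<tau>) (tau_part \<tau> A')"
  shows "equivalent_factors \<tau> A A' \<longleftrightarrow>
    (\<exists>B. holomorphic_GL_on B (-{0}) \<and>
      (\<forall>u\<in>-{0}. tau_part \<tau> A 1 u ** B u = B (nome \<tau> * u) ** tau_part \<tau> A' 1 u))"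
    (is "?L \<longleftrightarrow> ?R")
proof
  assume ?L
  then obtain B where "holomorphic_GL_on B (-{0})"
    and B: "\<forall>m::int. \<forall>u\<in>-{0}.
      tau_part \<tau> A m u ** B u = B (nome \<tau> powi m * u) ** tau_part \<tau> A' m u"
    unfolding equivalent_factors_def by blast
  moreover have "\<forall>u\<in>-{0}. tau_part \<tau> A 1 u ** B u = B (nome \<tau> * u) ** tau_part \<tau> A' 1 u"
    using B[THEN spec, of 1] by simp
  ultimately show ?R by blast
next
  assume ?R
  then show ?L
    unfolding equivalent_factors_def
    using q_cocycle_intertwines[OF assms] by (metis Compl_iff singletonI singletonD)
qed

lemma trivial_factor_iff_generator:
  assumes "q_cocycle (nome \<tau>) (tau_part \<tau> A)"
  shows "trivial_factor \<tau> A \<longleftrightarrow>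
    (\<exists>B. holomorphic_GL_on B (-{0}) \<and>
      (\<forall>u\<in>-{0}. tau_part \<tau> A 1 u = B (nome \<tau> * u) ** matrix_inv (B u)))"
proof -
  let ?I = "\<lambda>l u. mat 1 :: complex^'n^'n"
  \<comment> \<open>The constant identity is itself a cocycle, so the criterion for equivalence
    applies with it as second factor.\<close>
  have I: "q_cocycle (nome \<tau>) (tau_part \<tau> ?I)"
    by standard (auto simp: tau_part_def nome_def invertible_def)
  have "trivial_factor \<tau> A \<longleftrightarrow> (\<exists>B. holomorphic_GL_on B (-{0}) \<and>
      (\<forall>u\<in>-{0}. tau_part \<tau> A 1 u ** B u = B (nome \<tau> * u)))"
    unfolding trivial_factor_def equivalent_factors_iff_generator[OF assms I]
    by (simp add: tau_part_def)
  also have "\<dots> \<longleftrightarrow> (\<exists>B. holomorphic_GL_on B (-{0}) \<and>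
      (\<forall>u\<in>-{0}. tau_part \<tau> A 1 u = B (nome \<tau> * u) ** matrix_inv (B u)))"
    \<comment> \<open>The same \<open>B\<close> serves on both sides: since \<open>B u\<close> is
      invertible, it can be moved across the equation.\<close>
    by (intro ex_cong1 conj_cong refl ball_cong invertible_mult_right_iff)
      (simp_all add: holomorphic_GL_on_def)
  finally show ?thesis .
qed

theorem theorem4p10:
  fixes \<tau> q :: complex
    and A A' :: "complex \<Rightarrow> complex \<Rightarrow> complex^'n^'n"
  assumes "Im \<tau> > 0"
    and "q = nome \<tau>"
    and "factor_of_automorphy \<tau> A" and "depends_only_on_tau \<tau> A"
    and "factor_of_automorphy \<tau> A'" and "depends_only_on_tau \<tau> A'"
  shows
    "((\<forall>u\<in>-{0}. tau_part \<tau> A 1 u = tau_part \<tau> A' 1 u) \<longrightarrow>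
        (\<forall>m::int. \<forall>u\<in>-{0}. tau_part \<tau> A m u = tau_part \<tau> A' m u)) \<and>
     (\<forall>m::nat. m > 0 \<longrightarrow> (\<forall>u\<in>-{0}.
        tau_part \<tau> A (int m) u =
          matrix_prod_list (map (\<lambda>k. tau_part \<tau> A 1 (q ^ k * u)) (rev [0..<m])))) \<and>
     (\<forall>m::nat. m > 0 \<longrightarrow> (\<forall>u\<in>-{0}.
        tau_part \<tau> A (- int m) u =
          matrix_prod_list
            (map (\<lambda>k. matrix_inv (tau_part \<tau> A 1 (q powi (- int k) * u))) (rev [1..<Suc m])))) \<and>
     (equivalent_factors \<tau> A A' \<longleftrightarrow>
        (\<exists>B. holomorphic_GL_on B (-{0}) \<and>
           (\<forall>u\<in>-{0}. tau_part \<tau> A 1 u ** B u = B (q * u) ** tau_part \<tau> A' 1 u))) \<and>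
     (trivial_factor \<tau> A \<longleftrightarrow>
        (\<exists>B. holomorphic_GL_on B (-{0}) \<and>
           (\<forall>u\<in>-{0}. tau_part \<tau> A 1 u = B (q * u) ** matrix_inv (B u))))"
proof -
  have C: "q_cocycle (nome \<tau>) (tau_part \<tau> A)" and C': "q_cocycle (nome \<tau>) (tau_part \<tau> A')"
    using assms(3,5) by (simp_all add: factor_of_automorphy_q_cocycle)
  have "\<forall>m::int. \<forall>u\<in>-{0}. tau_part \<tau> A m u = tau_part \<tau> A' m u"
    if "\<forall>u\<in>-{0}. tau_part \<tau> A 1 u = tau_part \<tau> A' 1 u"
    using q_cocycle_intertwines[OF C C', of "\<lambda>_. mat 1"] that by simp
  then show ?thesis
    unfolding \<open>q = nome \<tau>\<close>
    by (intro conjI impI allI equivalent_factors_iff_generator[OF C C']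
        trivial_factor_iff_generator[OF C] ballI
        q_cocycle.nonneg_eq_prod[OF C] q_cocycle.nonpos_eq_prod[OF C]) auto
qed

end
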